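(* Let $\mathbb{L}^{\omega_1}=\{x\in[-1,1]^{\omega_1} : |\{\alpha<\omega_1 : x(\alpha)\neq 0\}|\le\omega\}$ with the lexicographic order. Any order isomorphism between subsets $X,Y\subseteq\mathbb{L}^{\omega_1}$ with $\operatorname{I-dim}X<\omega_1$ and $\operatorname{I-dim}Y<\omega_1$ extends to an automorphism of $\mathbb{L}^{\omega_1}$. In particular, any isomorphism between countable suborders of $\mathbb{L}^{\omega_1}$ extends to an automorphism of $\mathbb{L}^{\omega_1}$.
   Context: Work in ZFC. For an ordinal $\alpha$, $[-1,1]^\alpha$ is the set of functions $\alpha\to[-1,1]$ (real interval) ordered lexicographically. For a linear order $X$, $\operatorname{I-dim}X$ is the least ordinal $\alpha$ such that there is a (strictly) increasing function $X\to[-1,1]^\alpha$ (the same value is obtained with $\mathbb{R}$, $[0,1]$ or $2^\omega$ in place of $[-1,1]$). *)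

theory Defs
  imports "HOL-Library.FuncSet" "HOL-Library.Countable_Set" Complex_Main
begin

unbundle cardinal_syntax

text \<open>
  Ordinals are rendered as well-order relations, considered up to \<open>=o\<close> and compared by
  \<open>\<le>o\<close> and \<open><o\<close>; the positions below the ordinal \<open>r\<close> are the elements of \<open>Field r\<close>.
  The power of the interval is a space of extensional functions, so that distinct HOL functions
  in it differ at a position.
\<close>

definition interval_pow :: "'i rel \<Rightarrow> ('i \<Rightarrow> real) set"
  where "interval_pow r = Field r \<rightarrow>\<^sub>E {-1..1}"

definition lex_less :: "'i rel \<Rightarrow> ('i \<Rightarrow> real) \<Rightarrow> ('i \<Rightarrow> real) \<Rightarrow> bool"
  where "lex_less r x y \<longleftrightarrow> (\<exists>i\<in>Field r. x i < y i \<and> (\<forall>j\<in>underS r i. x j = y j))"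

definition has_increasing_map :: "'a set \<Rightarrow> ('a \<Rightarrow> 'a \<Rightarrow> bool) \<Rightarrow> 'i rel \<Rightarrow> bool"
  where "has_increasing_map A lt r \<longleftrightarrow>
    (\<exists>f\<in>A \<rightarrow> interval_pow r. monotone_on A lt (lex_less r) f)"

text \<open>
  Here \<open>lt\<close> is the strict order on \<open>A\<close>. The least ordinal is sought among the well-orders on
  the element type \<open>'a\<close>; this is no restriction, as shown by the lemmas
  \<open>I_dim_exists\<close> and \<open>I_dim_least\<close> below.
\<close>

definition is_I_dim :: "'a set \<Rightarrow> ('a \<Rightarrow> 'a \<Rightarrow> bool) \<Rightarrow> 'a rel \<Rightarrow> bool"
  where "is_I_dim A lt r \<longleftrightarrow> Well_order r \<and> has_increasing_map A lt r \<and>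
    (\<forall>s :: 'a rel. Well_order s \<and> has_increasing_map A lt s \<longrightarrow> r \<le>o s)"

definition I_dim :: "'a set \<Rightarrow> ('a \<Rightarrow> 'a \<Rightarrow> bool) \<Rightarrow> 'a rel"
  where "I_dim A lt = (SOME r. is_I_dim A lt r)"

definition omega1 :: "nat set rel"
  where "omega1 = cardSuc natLeq"

definition L_omega1 :: "(nat set \<Rightarrow> real) set"
  where "L_omega1 = {x \<in> interval_pow omega1. countable {i \<in> Field omega1. x i \<noteq> 0}}"

abbreviation L_less :: "(nat set \<Rightarrow> real) \<Rightarrow> (nat set \<Rightarrow> real) \<Rightarrow> bool"
  where "L_less \<equiv> lex_less omega1"

definition order_iso ::
    "('a \<Rightarrow> 'a \<Rightarrow> bool) \<Rightarrow> 'a set \<Rightarrow> ('b \<Rightarrow> 'b \<Rightarrow> bool) \<Rightarrow> 'b set \<Rightarrow> ('a \<Rightarrow> 'b) \<Rightarrow> bool"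
  where "order_iso lt A lt' B f \<longleftrightarrow>
    bij_betw f A B \<and> (\<forall>x\<in>A. \<forall>y\<in>A. lt x y \<longleftrightarrow> lt' (f x) (f y))"

lemma has_increasing_map_card:
  fixes A :: "'a set"
  assumes irrefl: "\<And>x. x \<in> A \<Longrightarrow> \<not> lt x x"
    and trans: "\<And>x y z. x \<in> A \<Longrightarrow> y \<in> A \<Longrightarrow> z \<in> A \<Longrightarrow> lt x y \<Longrightarrow> lt y z \<Longrightarrow> lt x z"
  shows "has_increasing_map A lt |A|"
proof -
  let ?r = "|A|"
  define f :: "'a \<Rightarrow> 'a \<Rightarrow> real"
    where "f x = (\<lambda>i\<in>A. if lt i x then 1 else 0)" for x
  have W: "Well_order ?r" by (rule card_of_Well_order)
  have "lex_less ?r (f x) (f y)" if x: "x \<in> A" and y: "y \<in> A" and xy: "lt x y" for x y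
  proof -
    let ?D = "{i \<in> A. f x i \<noteq> f y i}"
    have "x \<in> ?D"
      using x xy irrefl[OF x] by (simp add: f_def)
    then have "?D \<noteq> {}" and "?D \<subseteq> Field ?r" by (blast, simp add: Field_card_of)
    with W obtain i where i: "i \<in> ?D" and min: "\<forall>j\<in>?D. (i, j) \<in> ?r"
      using wo_rel.minim_in[of ?r ?D] wo_rel.minim_least[of ?r ?D] unfolding wo_rel_def by blast
    have "f x j = f y j" if "j \<in> underS ?r i" for j
    proof (rule ccontr)
      assume "f x j \<noteq> f y j"
      moreover have j: "j \<noteq> i" "(j, i) \<in> ?r" using that by (auto simp: underS_def)
      moreover from j have "j \<in> A" by (metis Field_card_of FieldI1)
      ultimately have "(i, j) \<in> ?r" using min by blast
      with j W show False
        unfolding order_on_defs by (metis antisymD)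
    qed
    moreover have "f x i < f y i"
    proof -
      have "i \<in> A" "f x i \<noteq> f y i" using i by auto
      then show ?thesis using trans[OF _ x y _ xy, of i] by (auto simp: f_def split: if_splits)
    qed
    ultimately show ?thesis
      using i unfolding lex_less_def by (metis (no_types, lifting) Field_card_of mem_Collect_eq)
  qed
  moreover have "f \<in> A \<rightarrow> interval_pow ?r"
    by (auto simp: f_def interval_pow_def Field_card_of)
  ultimately show ?thesis
    unfolding has_increasing_map_def by (blast intro: monotone_onI)
qed

lemma has_increasing_map_ordIso:
  assumes iso: "t =o s" and s: "has_increasing_map A lt s"
  shows "has_increasing_map A lt t"
proof -
  obtain h where Wt: "Well_order t" and Ws: "Well_order s" and h: "iso t s h"
    using iso unfolding ordIso_def by blast
  have bij: "bij_betw h (Field t) (Field s)" using h by (simp add: iso_def)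
  have under: "bij_betw h (underS t i) (underS s (h i))" if "i \<in> Field t" for i
    using embed_underS[OF Wt] h that Wt Ws unfolding iso_def by blast
  obtain f where f: "f \<in> A \<rightarrow> interval_pow s" and mono: "monotone_on A lt (lex_less s) f"
    using s unfolding has_increasing_map_def by blast
  define g where "g x = (\<lambda>i\<in>Field t. f x (h i))" for x
  have "g \<in> A \<rightarrow> interval_pow t"
    using f bij_betwE[OF bij] by (fastforce simp: g_def interval_pow_def PiE_iff)
  moreover have "lex_less t (g x) (g y)" if xy: "x \<in> A" "y \<in> A" "lt x y" for x y
  proof -
    obtain k where k: "k \<in> Field s" "f x k < f y k" "\<forall>j\<in>underS s k. f x j = f y j"
      using monotone_onD[OF mono xy] unfolding lex_less_def by blast
    then obtain i where i: "i \<in> Field t" "h i = k"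
      using bij_betw_imp_surj_on[OF bij] by (metis imageE)
    have "g x j = g y j" if "j \<in> underS t i" for j
      using that k(3) i bij_betwE[OF under[OF i(1)]] by (simp add: g_def)
    moreover have "g x i < g y i" using i k(2) by (simp add: g_def)
    ultimately show ?thesis using i(1) unfolding lex_less_def by blast
  qed
  ultimately show ?thesis
    unfolding has_increasing_map_def by (blast intro: monotone_onI)
qed

lemma I_dim_exists:
  fixes A :: "'a set"
  assumes "\<And>x. x \<in> A \<Longrightarrow> \<not> lt x x"
    and "\<And>x y z. x \<in> A \<Longrightarrow> y \<in> A \<Longrightarrow> z \<in> A \<Longrightarrow> lt x y \<Longrightarrow> lt y z \<Longrightarrow> lt x z"
  shows "is_I_dim A lt (I_dim A lt)"
proof -
  let ?R = "{r :: 'a rel. Well_order r \<and> has_increasing_map A lt r}"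
  have "|A| \<in> ?R" using has_increasing_map_card[of A lt] assms card_of_Well_order by blast
  then have "\<exists>r\<in>?R. \<forall>s\<in>?R. r \<le>o s" by (intro exists_minim_Well_order) auto
  then have "\<exists>r. is_I_dim A lt r" unfolding is_I_dim_def by blast
  then show ?thesis unfolding I_dim_def by (rule someI_ex)
qed

lemma I_dim_least:
  fixes A :: "'a set" and s :: "'i rel"
  assumes "\<And>x. x \<in> A \<Longrightarrow> \<not> lt x x"
    and "\<And>x y z. x \<in> A \<Longrightarrow> y \<in> A \<Longrightarrow> z \<in> A \<Longrightarrow> lt x y \<Longrightarrow> lt y z \<Longrightarrow> lt x z"
    and s: "Well_order s" "has_increasing_map A lt s"
  shows "I_dim A lt \<le>o s"
proof (rule ccontr)
  let ?d = "I_dim A lt"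
  have d: "is_I_dim A lt ?d" using I_dim_exists[of A lt] assms by blast
  then have W: "Well_order ?d" by (simp add: is_I_dim_def)
  assume "\<not> ?d \<le>o s"
  then have lt: "s <o ?d" using ordLess_or_ordLeq[OF s(1) W] by blast
  then obtain a where "s =o Restr ?d (underS ?d a)"
    using ordLess_iff_ordIso_Restr[OF W s(1)] by blast
  then have eq: "Restr ?d (underS ?d a) =o s" by (rule ordIso_symmetric)
  have "?d \<le>o Restr ?d (underS ?d a)"
    using d has_increasing_map_ordIso[OF eq s(2)] Well_order_Restr[OF W]
    unfolding is_I_dim_def by blast
  then have "?d \<le>o s" using eq by (rule ordLeq_ordIso_trans)
  with \<open>\<not> ?d \<le>o s\<close> show False by blast
qed

end

theory Submission
  imports Defs
begin

text \<open>
  A subset \<open>X\<close> with \<open>I-dim X < \<omega>\<^sub>1\<close> is short: each of its subsets has a countable cofinal and a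
  countable coinitial subset. The ordering is the union of the \<open>\<omega>\<^sub>1\<close> short levels of the functions
  that vanish beyond some \<open>d < \<omega>\<^sub>1\<close>, and short sets are closed under countable unions. Every cut
  with countable sides is filled by a copy of the whole ordering. Hence an isomorphism of short
  subsets extends to any further short set: the new elements in a cut are sent into the copy that
  fills the image cut. A back-and-forth construction of length \<open>\<omega>\<^sub>1\<close> gives the automorphism.
\<close>

section \<open>Lexicographic comparison along a well-order\<close>

text \<open>The obstacle is size: a level with a position below \<open>d\<close> already has as many
  elements as the continuum. Adding them one at a time would, without CH, take more than
  \<open>omega1\<close> steps, and shortness need not survive uncountable unions. So a whole short
  set is added in one step, and all its elements that fall into the same cut must be placed at once.
  This is why one filling point is not enough and each gap has to receive a copy of the whole
  ordering. Countable supports make room for it: a countable family vanishes from some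
  \<open>d\<close> on, so the position \<open>d\<close> is free to separate the copy from the
  family, and the positions beyond \<open>d\<close> carry the copy. Shortness is invariant under
  isomorphism, so it passes from the domain to the range, where the image cuts have to be filled.
  Every stage of the recursion has only countably many predecessors, so each stage stays short
  although the final union does not.\<close>

lemma underS_trans:
  assumes "Well_order r" "i \<in> underS r j" "j \<in> underS r k"
  shows "i \<in> underS r k"
  using assms unfolding underS_def order_on_defs
  by (auto dest: transD antisymD)

lemma underS_in_Field: "i \<in> underS r j \<Longrightarrow> i \<in> Field r \<and> j \<in> Field r"
  by (auto simp: underS_def Field_def)

lemma underS_irrefl: "i \<notin> underS r i"
  by (simp add: underS_def)

lemma underS_cases:
  assumes "Well_order r" "i \<in> Field r" "j \<in> Field r"
  obtains "i = j" | "i \<in> underS r j" | "j \<in> underS r i"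
  using assms unfolding underS_def order_on_defs total_on_def by blast

lemma wf_underS:
  assumes "Well_order r"
  shows "wf {(i, j). i \<in> underS r j}"
proof -
  have "{(i, j). i \<in> underS r j} = r - Id" by (auto simp: underS_def)
  with assms show ?thesis by (simp add: well_order_on_def)
qed

lemma underS_least:
  assumes "Well_order r" "k \<in> K"
  shows "\<exists>i\<in>K. \<forall>j\<in>underS r i. j \<notin> K"
proof (rule wfE_min[OF wf_underS[OF assms(1)] assms(2)])
  fix i assume "i \<in> K" "\<And>j. (j, i) \<in> {(i, j). i \<in> underS r j} \<Longrightarrow> j \<notin> K"
  then show ?thesis by (intro bexI[of _ i]) auto
qed

lemma lex_less_irrefl: "\<not> lex_less r x x"
  by (simp add: lex_less_def)

lemma lex_less_trans:
  assumes W: "Well_order r" and "lex_less r x y" "lex_less r y z"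
  shows "lex_less r x z"
proof -
  obtain i where i: "i \<in> Field r" "x i < y i" "\<And>j. j \<in> underS r i \<Longrightarrow> x j = y j"
    using assms(2) unfolding lex_less_def by blast
  obtain k where k: "k \<in> Field r" "y k < z k" "\<And>j. j \<in> underS r k \<Longrightarrow> y j = z j"
    using assms(3) unfolding lex_less_def by blast
  show ?thesis
  proof (rule underS_cases[OF W i(1) k(1)])
    assume "i = k"
    then show ?thesis using i k unfolding lex_less_def by (metis less_trans)
  next
    assume "i \<in> underS r k"
    then show ?thesis using i k underS_trans[OF W] unfolding lex_less_def by metis
  next
    assume "k \<in> underS r i"
    then show ?thesis using i k underS_trans[OF W] unfolding lex_less_def by metis
  qed
qed

lemma lex_less_asym: "Well_order r \<Longrightarrow> lex_less r x y \<Longrightarrow> \<not> lex_less r y x"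
  using lex_less_trans lex_less_irrefl by metis

lemma lex_less_linear:
  assumes W: "Well_order r" and "i \<in> Field r" "x i \<noteq> y i"
  shows "lex_less r x y \<or> lex_less r y x"
proof -
  have "i \<in> {j \<in> Field r. x j \<noteq> y j}" using assms by simp
  from underS_least[OF W this]
  obtain m where m: "m \<in> Field r" "x m \<noteq> y m"
    "\<forall>j\<in>underS r m. j \<notin> {j \<in> Field r. x j \<noteq> y j}"
    by blast
  then have "\<forall>j\<in>underS r m. x j = y j" using underS_in_Field by fastforce
  moreover have "x m < y m \<or> y m < x m" using m(2) by linarith
  ultimately show ?thesis using m(1) unfolding lex_less_def by metis
qed

section \<open>Countable cofinality\<close>

text \<open>All subsets are tested because the sides of a cut are arbitrary subsets. The order is a
  parameter so that coinitiality is the same notion for the reversed order.\<close>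

definition countably_cofinal :: "('a \<Rightarrow> 'a \<Rightarrow> bool) \<Rightarrow> 'a set \<Rightarrow> bool"
  where "countably_cofinal lt X \<longleftrightarrow>
    (\<forall>A\<subseteq>X. \<exists>D\<subseteq>A. countable D \<and> (\<forall>a\<in>A. \<exists>d\<in>D. a = d \<or> lt a d))"

lemma countably_cofinalD:
  "countably_cofinal lt X \<Longrightarrow> A \<subseteq> X \<Longrightarrow>
    \<exists>D\<subseteq>A. countable D \<and> (\<forall>a\<in>A. \<exists>d\<in>D. a = d \<or> lt a d)"
  unfolding countably_cofinal_def by (drule spec[of _ A]) (erule mp)

lemma countably_cofinal_countable: "countable X \<Longrightarrow> countably_cofinal lt X"
  unfolding countably_cofinal_def
proof (intro allI impI)
  fix A assume "countable X" "A \<subseteq> X"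
  then show "\<exists>D\<subseteq>A. countable D \<and> (\<forall>a\<in>A. \<exists>d\<in>D. a = d \<or> lt a d)"
    by (intro exI[of _ A]) (auto intro: countable_subset)
qed

lemma countably_cofinal_subset:
  assumes "countably_cofinal lt X" "Y \<subseteq> X"
  shows "countably_cofinal lt Y"
  unfolding countably_cofinal_def
proof (intro allI impI)
  fix A assume "A \<subseteq> Y"
  then have "A \<subseteq> X" using assms(2) by (rule order_trans)
  with assms(1) show "\<exists>D\<subseteq>A. countable D \<and> (\<forall>a\<in>A. \<exists>d\<in>D. a = d \<or> lt a d)"
    by (rule countably_cofinalD)
qed

lemma countably_cofinal_UN:
  assumes "countable I" and X: "\<And>i. i \<in> I \<Longrightarrow> countably_cofinal lt (X i)"
  shows "countably_cofinal lt (\<Union>i\<in>I. X i)"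
  unfolding countably_cofinal_def
proof (intro allI impI)
  fix A assume A: "A \<subseteq> (\<Union>i\<in>I. X i)"
  have "\<forall>i\<in>I. \<exists>D\<subseteq>A \<inter> X i. countable D \<and> (\<forall>a\<in>A \<inter> X i. \<exists>d\<in>D. a = d \<or> lt a d)"
  proof
    fix i assume "i \<in> I"
    from countably_cofinalD[OF X[OF this], of "A \<inter> X i"]
    show "\<exists>D\<subseteq>A \<inter> X i. countable D \<and> (\<forall>a\<in>A \<inter> X i. \<exists>d\<in>D. a = d \<or> lt a d)"
      by simp
  qed
  then obtain D where D: "\<forall>i\<in>I. D i \<subseteq> A \<inter> X i \<and> countable (D i) \<and>
      (\<forall>a\<in>A \<inter> X i. \<exists>d\<in>D i. a = d \<or> lt a d)"
    by metis
  then have "(\<Union>i\<in>I. D i) \<subseteq> A" "countable (\<Union>i\<in>I. D i)"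
    using assms(1) by auto
  moreover have "\<exists>d\<in>(\<Union>i\<in>I. D i). a = d \<or> lt a d" if "a \<in> A" for a
  proof -
    obtain i where i: "i \<in> I" "a \<in> A \<inter> X i" using A \<open>a \<in> A\<close> by blast
    then obtain d where "d \<in> D i" "a = d \<or> lt a d" using D by metis
    then show ?thesis using i(1) by blast
  qed
  ultimately show "\<exists>D\<subseteq>A. countable D \<and> (\<forall>a\<in>A. \<exists>d\<in>D. a = d \<or> lt a d)"
    by (intro exI[of _ "\<Union>i\<in>I. D i"] conjI ballI)
qed

lemma countably_cofinal_Un:
  assumes "countably_cofinal lt X" "countably_cofinal lt Y"
  shows "countably_cofinal lt (X \<union> Y)"
  using countably_cofinal_UN[of "{X, Y}" lt id] assms by auto

text \<open>A subset of the range is pulled back along \<open>G\<close>, a countable cofinal subset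
  of the preimage is chosen there, and its images are cofinal by monotonicity. Single-valuedness
  covers the case where the chosen point is the preimage itself.\<close>

lemma countably_cofinal_Range:
  assumes dom: "countably_cofinal lt (Domain G)"
    and mono: "\<And>a b c d. (a, b) \<in> G \<Longrightarrow> (c, d) \<in> G \<Longrightarrow> lt a c \<Longrightarrow> lt b d"
    and single: "\<And>a b d. (a, b) \<in> G \<Longrightarrow> (a, d) \<in> G \<Longrightarrow> b = d"
  shows "countably_cofinal lt (Range G)"
  unfolding countably_cofinal_def
proof (intro allI impI)
  fix B assume B: "B \<subseteq> Range G"
  define A where "A = {a. \<exists>b\<in>B. (a, b) \<in> G}"
  have "A \<subseteq> Domain G" by (auto simp: A_def)
  from countably_cofinalD[OF dom this]
  obtain D where D: "D \<subseteq> A" "countable D" "\<forall>a\<in>A. \<exists>d\<in>D. a = d \<or> lt a d"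
    by (elim exE conjE)
  have "\<forall>d\<in>D. \<exists>b\<in>B. (d, b) \<in> G" using D(1) by (auto simp: A_def)
  then obtain g where g: "\<forall>d\<in>D. g d \<in> B \<and> (d, g d) \<in> G" by metis
  have "\<exists>e\<in>g ` D. b = e \<or> lt b e" if "b \<in> B" for b
  proof -
    obtain a where a: "(a, b) \<in> G" using B \<open>b \<in> B\<close> by blast
    then have "a \<in> A" using \<open>b \<in> B\<close> by (auto simp: A_def)
    then obtain d where "d \<in> D" "a = d \<or> lt a d" using D(3) by blast
    then show ?thesis using a g mono single by blast
  qed
  then show "\<exists>D\<subseteq>B. countable D \<and> (\<forall>a\<in>B. \<exists>d\<in>D. a = d \<or> lt a d)"
    using D(2) g by (intro exI[of _ "g ` D"]) auto
qed

text \<open>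
  If \<open>y > x\<close> in \<open>A\<close> first differs from \<open>x\<close> at the least possible \<open>i\<close>, then no element above \<open>y\<close>
  changes the coordinates below \<open>i\<close>. So any element with this property whose coordinate at \<open>i\<close>
  exceeds a rational between \<open>x i\<close> and \<open>y i\<close> is above \<open>x\<close>; choosing one for each \<open>i\<close> and each
  rational suffices.
\<close>

lemma countable_cofinal_set:
  fixes f :: "'a \<Rightarrow> 'i \<Rightarrow> real"
  assumes W: "Well_order r" and K: "countable K" "K \<subseteq> Field r"
    and total: "\<And>x y. x \<in> A \<Longrightarrow> y \<in> A \<Longrightarrow> x = y \<or> lt x y \<or> lt y x"
    and inc: "\<And>x y. x \<in> A \<Longrightarrow> y \<in> A \<Longrightarrow> lt x y \<Longrightarrow>
      \<exists>i\<in>K. f x i < f y i \<and> (\<forall>j\<in>underS r i. f x j = f y j)"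
  shows "\<exists>D\<subseteq>A. countable D \<and> (\<forall>a\<in>A. \<exists>d\<in>D. a = d \<or> lt a d)"
proof -
  define E where "E i q = {y \<in> A. real_of_rat q < f y i \<and>
    (\<forall>z\<in>A. lt y z \<longrightarrow> (\<forall>j\<in>underS r i. f z j = f y j))}" for i q
  define M where "M = {m \<in> A. \<forall>y\<in>A. \<not> lt m y}"
  \<comment> \<open>Intersecting with \<open>M\<close> discards the arbitrary \<open>SOME\<close>
    value when \<open>A\<close> has no maximal element.\<close>
  define D where
    "D = {SOME m. m \<in> M} \<inter> M \<union> (\<lambda>(i, q). SOME d. d \<in> E i q) ` {(i, q). i \<in> K \<and> E i q \<noteq> {}}"
  have "countable {(i, q). i \<in> K \<and> E i q \<noteq> {}}"
    by (rule countable_subset[of _ "K \<times> (UNIV :: rat set)"]) (use K in auto)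
  then have cD: "countable D" unfolding D_def
    by (intro countable_Un countable_image) auto
  have "(SOME d. d \<in> E i q) \<in> A" if "E i q \<noteq> {}" for i q
  proof -
    from that have "(SOME d. d \<in> E i q) \<in> E i q" by (simp add: some_in_eq)
    then show ?thesis by (simp add: E_def)
  qed
  moreover have "M \<subseteq> A" by (simp add: M_def)
  ultimately have DA: "D \<subseteq> A" unfolding D_def by (intro Un_least) auto
  have "\<exists>d\<in>D. x = d \<or> lt x d" if x: "x \<in> A" for x
  proof (cases "x \<in> M")
    case True
    then have "(SOME m. m \<in> M) \<in> M" by (rule someI)
    moreover then have "(SOME m. m \<in> M) \<in> D" by (simp add: D_def)
    ultimately show ?thesis using total[OF x] True unfolding M_def by blast
  next
    case False
    let ?K = "{i \<in> K. \<exists>y\<in>A. f x i < f y i \<and> (\<forall>j\<in>underS r i. f x j = f y j)}"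
    obtain y0 where "y0 \<in> A" "lt x y0" using x False by (auto simp: M_def)
    then obtain k0 where "k0 \<in> ?K" using inc[OF x] by blast
    from underS_least[OF W this]
    obtain i where i: "i \<in> ?K" and least: "\<forall>j\<in>underS r i. j \<notin> ?K"
      by (elim bexE)
    then obtain y where y: "y \<in> A" "f x i < f y i" "\<forall>j\<in>underS r i. f x j = f y j"
      by blast
    obtain q where q: "f x i < real_of_rat q" "real_of_rat q < f y i"
      using of_rat_dense[OF y(2)] by blast
    have iF: "i \<in> K" "i \<in> Field r" using i K by auto
    have "\<forall>j\<in>underS r i. f z j = f y j" if z: "z \<in> A" "lt y z" for z
    proof -
      obtain k where k: "k \<in> K" "f y k < f z k" "\<forall>j\<in>underS r k. f y j = f z j"
        using inc[OF y(1) z] by blast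
      \<comment> \<open>Otherwise \<open>z\<close> would first exceed \<open>x\<close> at
        \<open>k\<close>, below the least possible position \<open>i\<close>.\<close>
      have "k \<notin> underS r i"
      proof
        assume ki: "k \<in> underS r i"
        then have "f x k < f z k" "\<forall>j\<in>underS r k. f x j = f z j"
          using y(3) k underS_trans[OF W] by (metis, metis)
        then show False using least ki k(1) z(1) by blast
      qed
      then have "underS r i \<subseteq> underS r k"
        using underS_cases[OF W iF(2), of k] underS_trans[OF W] k(1) K by blast
      then show ?thesis using k(3) by auto
    qed
    then have yE: "y \<in> E i q" using y q by (simp add: E_def)
    define d where "d = (SOME d. d \<in> E i q)"
    have dE: "d \<in> E i q" unfolding d_def using yE by (rule someI)
    have "d \<in> D" unfolding D_def d_def using yE iF(1) by auto
    have dA: "d \<in> A" using dE by (simp add: E_def)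
    \<comment> \<open>Whichever of \<open>d\<close> and \<open>y\<close> is smaller, its membership
      in \<open>E i q\<close> forces the larger one to keep the coordinates below
      \<open>i\<close>.\<close>
    have "\<forall>j\<in>underS r i. f d j = f y j"
      using total[OF dA y(1)] dE yE dA y(1) unfolding E_def by auto
    then have dx: "\<forall>j\<in>underS r i. f d j = f x j" using y(3) by simp
    have xd: "f x i < f d i" using dE q by (simp add: E_def)
    have "\<not> lt d x"
    proof
      assume "lt d x"
      then obtain k where k: "k \<in> K" "f d k < f x k" "\<forall>j\<in>underS r k. f d j = f x j"
        using inc[OF dA x] by blast
      then have "k \<in> Field r" using K by blast
      from underS_cases[OF W iF(2) this] show False
        using k dx xd by (metis less_irrefl less_asym)
    qed
    then show ?thesis using total[OF x dA] \<open>d \<in> D\<close> by blast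
  qed
  then show ?thesis using cD DA by blast
qed

section \<open>The ordinal \<open>\<omega>\<^sub>1\<close>\<close>

lemma Card_order_omega1: "Card_order omega1"
  unfolding omega1_def by (simp add: cardSuc_Card_order natLeq_Card_order)

lemma Well_order_omega1: "Well_order omega1"
  using Card_order_omega1 by (simp add: card_order_on_def)

lemmas omega1_cases = underS_cases[OF Well_order_omega1]
lemmas omega1_trans = underS_trans[OF Well_order_omega1]
lemmas L_less_trans = lex_less_trans[OF Well_order_omega1]
lemmas L_less_asym = lex_less_asym[OF Well_order_omega1]

lemma countable_iff_natLeq: "countable A \<longleftrightarrow> |A| \<le>o natLeq"
proof -
  have "|UNIV :: nat set| =o natLeq"
    using card_of_Field_ordIso[OF natLeq_Card_order] by (simp add: Field_natLeq)
  moreover have "countable A \<longleftrightarrow> |A| \<le>o |UNIV :: nat set|"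
    by (simp add: countable_def card_of_ordLeq[symmetric])
  ultimately show ?thesis
    using ordLeq_ordIso_trans ordIso_symmetric by blast
qed

lemma countable_Field_less_omega1:
  assumes "r <o omega1"
  shows "countable (Field r)"
proof -
  have "Well_order r" using assms by (simp add: ordLess_def)
  then have "|Field r| \<le>o r" by (rule card_of_least)
  then have "|Field r| <o omega1" using assms by (rule ordLeq_ordLess_trans)
  then show ?thesis
    by (simp add: omega1_def countable_iff_natLeq
        cardSuc_ordLeq_ordLess[OF natLeq_Card_order card_of_Card_order])
qed

lemma countable_underS_omega1: "countable (underS omega1 i)"
proof (cases "i \<in> Field omega1")
  case True
  have "|underS omega1 i| <o omega1" using Card_order_omega1 True by (rule card_of_underS)
  from countable_Field_less_omega1[OF this] show ?thesis by (simp add: Field_card_of)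
next
  case False
  then have "underS omega1 i = {}" using underS_in_Field by fastforce
  then show ?thesis by simp
qed

lemma uncountable_Field_omega1: "\<not> countable (Field omega1)"
proof
  assume "countable (Field omega1)"
  then have "|Field omega1| \<le>o natLeq" by (simp add: countable_iff_natLeq)
  moreover have "natLeq <o omega1"
    unfolding omega1_def by (simp add: cardSuc_greater natLeq_Card_order)
  moreover have "|Field omega1| =o omega1"
    by (rule card_of_Field_ordIso[OF Card_order_omega1])
  ultimately show False
    using not_ordLess_ordIso ordLeq_ordLess_trans by blast
qed

text \<open>Regularity of \<open>omega1\<close>: countably many countable initial segments do not
  exhaust it, and a point outside all of them lies above all of \<open>S\<close>.\<close>

lemma omega1_bound:
  assumes "countable S" "S \<subseteq> Field omega1"
  obtains i where "i \<in> Field omega1" "S \<subseteq> underS omega1 i"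
proof -
  have "countable (\<Union>s\<in>S. insert s (underS omega1 s))"
    using assms countable_underS_omega1 by auto
  then have "\<not> Field omega1 \<subseteq> (\<Union>s\<in>S. insert s (underS omega1 s))"
    using uncountable_Field_omega1 countable_subset by blast
  then obtain i where i: "i \<in> Field omega1" "i \<notin> (\<Union>s\<in>S. insert s (underS omega1 s))"
    by blast
  have "S \<subseteq> underS omega1 i"
  proof
    fix s assume "s \<in> S"
    then show "s \<in> underS omega1 i" using omega1_cases[of i s] i assms(2) by blast
  qed
  with i(1) show ?thesis by (rule that)
qed

text \<open>A strictly increasing \<open>h\<close> with values beyond \<open>d\<close> moves the
  coordinates of a point past a prescribed prefix without changing comparisons. It exists by
  recursion, since the values chosen so far are countably many and hence bounded.\<close>

lemma omega1_shift:
  assumes "d \<in> Field omega1"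
  shows "\<exists>h. \<forall>i. d \<in> underS omega1 (h i) \<and> (\<forall>j\<in>underS omega1 i. h j \<in> underS omega1 (h i))"
proof -
  let ?R = "{(i, j). i \<in> underS omega1 j}"
  let ?P = "\<lambda>h i k. d \<in> underS omega1 k \<and> (\<forall>j\<in>underS omega1 i. h j \<in> underS omega1 k)"
  show "\<exists>h. \<forall>i. ?P h i (h i)"
  proof (rule dependent_wf_choice[OF wf_underS[OF Well_order_omega1]])
    fix h i assume h: "\<And>j. (j, i) \<in> ?R \<Longrightarrow> ?P h j (h j)"
    have "countable (insert d (h ` underS omega1 i))" using countable_underS_omega1 by simp
    moreover have "insert d (h ` underS omega1 i) \<subseteq> Field omega1"
      using h assms underS_in_Field by fastforce
    ultimately obtain k where "insert d (h ` underS omega1 i) \<subseteq> underS omega1 k"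
      by (rule omega1_bound)
    then show "\<exists>k. ?P h i k" by blast
  qed auto
qed

section \<open>Short subsets of the ordering\<close>

text \<open>For a linear order this means that neither \<open>omega1\<close> nor its reverse
  embeds.\<close>

definition short :: "(nat set \<Rightarrow> real) set \<Rightarrow> bool"
  where "short X \<longleftrightarrow> countably_cofinal L_less X \<and> countably_cofinal (\<lambda>x y. L_less y x) X"

lemma L_omega1_range:
  assumes "x \<in> L_omega1" "i \<in> Field omega1"
  shows "-1 \<le> x i" "x i \<le> 1"
proof -
  have "x i \<in> {-1..1}"
    using assms by (auto simp: L_omega1_def interval_pow_def intro: PiE_mem)
  then show "-1 \<le> x i" "x i \<le> 1" by auto
qed

lemma L_less_linear:
  assumes "x \<in> L_omega1" "y \<in> L_omega1"
  shows "x = y \<or> L_less x y \<or> L_less y x"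
proof (cases "x = y")
  case False
  have "x \<in> extensional (Field omega1)" "y \<in> extensional (Field omega1)"
    using assms by (auto simp: L_omega1_def interval_pow_def PiE_def)
  then obtain i where "i \<in> Field omega1" "x i \<noteq> y i"
    using False by (meson extensionalityI)
  then show ?thesis using lex_less_linear[OF Well_order_omega1] by blast
qed simp

lemma short_Un: "short X \<Longrightarrow> short Y \<Longrightarrow> short (X \<union> Y)"
  unfolding short_def by (simp add: countably_cofinal_Un)

lemma short_UN: "countable I \<Longrightarrow> (\<And>i. i \<in> I \<Longrightarrow> short (X i)) \<Longrightarrow> short (\<Union>i\<in>I. X i)"
  unfolding short_def by (simp add: countably_cofinal_UN)

text \<open>The set \<open>K\<close> of relevant positions is separate from \<open>Field r\<close>
  to cover two cases: a countable dimension, where \<open>K\<close> is the whole field, and a level,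
  where the order is still \<open>omega1\<close> but only the positions below \<open>d\<close>
  matter.\<close>

lemma short_lex:
  fixes f :: "(nat set \<Rightarrow> real) \<Rightarrow> 'i \<Rightarrow> real"
  assumes W: "Well_order r" and K: "countable K" "K \<subseteq> Field r" and X: "X \<subseteq> L_omega1"
    and inc: "\<And>x y. x \<in> X \<Longrightarrow> y \<in> X \<Longrightarrow> L_less x y \<Longrightarrow>
      \<exists>i\<in>K. f x i < f y i \<and> (\<forall>j\<in>underS r i. f x j = f y j)"
  shows "short X"
  unfolding short_def countably_cofinal_def
proof (intro conjI allI impI)
  fix A assume A: "A \<subseteq> X"
  show "\<exists>D\<subseteq>A. countable D \<and> (\<forall>a\<in>A. \<exists>d\<in>D. a = d \<or> L_less a d)"
  proof (rule countable_cofinal_set[OF W K])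
    fix x y assume "x \<in> A" "y \<in> A"
    then show "x = y \<or> L_less x y \<or> L_less y x" using A X by (intro L_less_linear) auto
  next
    fix x y assume "x \<in> A" "y \<in> A" "L_less x y"
    then show "\<exists>i\<in>K. f x i < f y i \<and> (\<forall>j\<in>underS r i. f x j = f y j)"
      using A by (intro inc) auto
  qed
  \<comment> \<open>Negating all coordinates reverses the lexicographic order and turns coinitial
    into cofinal.\<close>
  show "\<exists>D\<subseteq>A. countable D \<and> (\<forall>a\<in>A. \<exists>d\<in>D. a = d \<or> L_less d a)"
  proof (rule countable_cofinal_set[OF W K, where f = "\<lambda>x i. - f x i"])
    fix x y assume "x \<in> A" "y \<in> A"
    then show "x = y \<or> L_less y x \<or> L_less x y" using A X L_less_linear[of x y] by auto
  next
    fix x y assume "x \<in> A" "y \<in> A" "L_less y x"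
    then have "\<exists>i\<in>K. f y i < f x i \<and> (\<forall>j\<in>underS r i. f y j = f x j)"
      using A by (intro inc) auto
    then show "\<exists>i\<in>K. - f x i < - f y i \<and> (\<forall>j\<in>underS r i. - f x j = - f y j)" by auto
  qed
qed

lemma short_I_dim:
  assumes X: "X \<subseteq> L_omega1" and dim: "I_dim X L_less <o omega1"
  shows "short X"
proof -
  let ?r = "I_dim X L_less"
  have "is_I_dim X L_less ?r"
    by (rule I_dim_exists) (use lex_less_irrefl L_less_trans in blast)+
  then have W: "Well_order ?r" and "has_increasing_map X L_less ?r"
    by (auto simp: is_I_dim_def)
  then obtain f where f: "monotone_on X L_less (lex_less ?r) f"
    unfolding has_increasing_map_def by blast
  show ?thesis
  proof (rule short_lex[OF W countable_Field_less_omega1[OF dim] order_refl X])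
    fix x y assume "x \<in> X" "y \<in> X" "L_less x y"
    with monotone_onD[OF f]
    show "\<exists>i\<in>Field ?r. f x i < f y i \<and> (\<forall>j\<in>underS ?r i. f x j = f y j)"
      unfolding lex_less_def by blast
  qed
qed

lemma short_countable: "countable X \<Longrightarrow> short X"
  by (simp add: short_def countably_cofinal_countable)

definition level :: "nat set \<Rightarrow> (nat set \<Rightarrow> real) set"
  where "level d = {x \<in> L_omega1. \<forall>i\<in>Field omega1. i \<notin> underS omega1 d \<longrightarrow> x i = 0}"

text \<open>Two elements of \<open>level d\<close> both vanish from \<open>d\<close> on, so they can
  differ only at the countably many positions below \<open>d\<close>.\<close>

lemma short_level: "short (level d)"
proof (rule short_lex[OF Well_order_omega1 countable_underS_omega1[of d]])
  show "underS omega1 d \<subseteq> Field omega1" using underS_in_Field by fastforce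
  show "level d \<subseteq> L_omega1" by (auto simp: level_def)
  fix x y assume xy: "x \<in> level d" "y \<in> level d" and "L_less x y"
  then obtain i where i: "i \<in> Field omega1" "x i < y i" "\<forall>j\<in>underS omega1 i. x j = y j"
    unfolding lex_less_def by blast
  then have "i \<in> underS omega1 d" using xy unfolding level_def by fastforce
  then show "\<exists>i\<in>underS omega1 d. x i < y i \<and> (\<forall>j\<in>underS omega1 i. x j = y j)"
    using i by blast
qed

text \<open>A countable union of countable supports is bounded in \<open>omega1\<close>. Applied to
  singletons, this shows that the levels exhaust the ordering.\<close>

lemma countable_subset_level:
  assumes "countable A" "A \<subseteq> L_omega1"
  obtains d where "d \<in> Field omega1" "A \<subseteq> level d"
proof -
  have "countable (\<Union>a\<in>A. {i \<in> Field omega1. a i \<noteq> 0})"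
    using assms by (intro countable_UN) (auto simp: L_omega1_def)
  moreover have "(\<Union>a\<in>A. {i \<in> Field omega1. a i \<noteq> 0}) \<subseteq> Field omega1" by blast
  ultimately obtain d where d: "d \<in> Field omega1"
    "(\<Union>a\<in>A. {i \<in> Field omega1. a i \<noteq> 0}) \<subseteq> underS omega1 d"
    by (rule omega1_bound)
  then have "A \<subseteq> level d" using assms(2) by (auto simp: level_def)
  with d(1) show ?thesis by (rule that)
qed

section \<open>Filling countable cuts\<close>

text \<open>
  The supremum at \<open>i\<close> ranges only over the elements of \<open>A\<close> from which on the coordinates below \<open>i\<close>
  are constant in \<open>A\<close>; the coordinate is \<open>-1\<close> where there are none.
\<close>

lemma lex_sup:
  fixes A :: "('i \<Rightarrow> real) set"
  assumes W: "Well_order r" and A: "\<And>a i. a \<in> A \<Longrightarrow> i \<in> Field r \<Longrightarrow> -1 \<le> a i \<and> a i \<le> 1"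
    and total: "\<And>a b. a \<in> A \<Longrightarrow> b \<in> A \<Longrightarrow> a = b \<or> lex_less r a b \<or> lex_less r b a"
  shows "\<exists>p. (\<forall>i. -1 \<le> p i \<and> p i \<le> 1) \<and>
    (\<forall>a\<in>A. lex_less r a p \<or> (\<forall>i\<in>Field r. a i = p i)) \<and>
    (\<forall>b. (\<forall>i\<in>Field r. -1 \<le> b i) \<and> (\<forall>a\<in>A. lex_less r a b) \<longrightarrow>
      lex_less r p b \<or> (\<forall>i\<in>Field r. b i = p i))"
proof -
  define settled where "settled i =
    {a \<in> A. \<forall>b\<in>A. lex_less r a b \<longrightarrow> (\<forall>j\<in>underS r i. a j = b j)}" for i
  define S where "S i = insert (-1) ((\<lambda>a. a i) ` settled i)" for i
  define p where "p i = (if i \<in> Field r then Sup (S i) else 0)" for i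
  have S: "-1 \<in> S i" "bdd_above (S i)" "\<And>s. s \<in> S i \<Longrightarrow> s \<le> 1" if "i \<in> Field r" for i
  proof -
    show "-1 \<in> S i" by (simp add: S_def)
    show le: "s \<le> 1" if "s \<in> S i" for s
      using that A \<open>i \<in> Field r\<close> by (auto simp: S_def settled_def)
    then show "bdd_above (S i)" unfolding bdd_above_def by blast
  qed
  have p_ge: "s \<le> p i" if "i \<in> Field r" "s \<in> S i" for s i
    using S[OF that(1)] that by (auto simp: p_def intro: cSup_upper)
  have range: "-1 \<le> p i \<and> p i \<le> 1" for i
  proof (cases "i \<in> Field r")
    case True
    have "Sup (S i) \<le> 1" using S[OF True] by (intro cSup_least) auto
    then show ?thesis using p_ge[OF True S(1)[OF True]] True by (simp add: p_def)
  qed (simp add: p_def)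
  have settled_agree: "a j = b j"
    if "a \<in> settled i" "b \<in> settled i" "j \<in> underS r i" for a b i j
  proof -
    have "a \<in> A" "b \<in> A" using that by (auto simp: settled_def)
    from total[OF this] show ?thesis using that \<open>a \<in> A\<close> \<open>b \<in> A\<close>
      unfolding settled_def by fastforce
  qed
  have settled_down: "a \<in> settled j" if "a \<in> settled i" "j \<in> underS r i" for a i j
    using that underS_trans[OF W _ that(2)] unfolding settled_def by blast
  \<comment> \<open>The supremum at \<open>j\<close> is attained by \<open>a\<close>. An element
    \<open>b\<close> settled at \<open>j\<close> and above \<open>a\<close> agrees with
    \<open>a\<close> at \<open>j\<close>; one below \<open>a\<close> agrees with it before
    \<open>j\<close>, so it cannot exceed it at \<open>j\<close>.\<close>
  have p_settled: "p j = a j" if a: "a \<in> settled i" and j: "j \<in> underS r i" for a i j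
  proof -
    have jF: "j \<in> Field r" using underS_in_Field[OF j] by simp
    have aj: "a \<in> settled j" using settled_down[OF a j] .
    then have "a \<in> A" by (simp add: settled_def)
    have "s \<le> a j" if "s \<in> S j" for s
    proof (cases "s = -1")
      case True
      then show ?thesis using A[OF \<open>a \<in> A\<close> jF] by simp
    next
      case False
      then obtain b where b: "b \<in> settled j" "s = b j" using \<open>s \<in> S j\<close> by (auto simp: S_def)
      then have bA: "b \<in> A" by (simp add: settled_def)
      from total[OF \<open>a \<in> A\<close> bA] show ?thesis
      proof (elim disjE)
        assume "lex_less r a b"
        then have "a j = b j" using a j bA unfolding settled_def by blast
        then show ?thesis using b by simp
      next
        assume "lex_less r b a"
        then obtain k where k: "k \<in> Field r" "b k < a k" "\<forall>m\<in>underS r k. b m = a m"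
          unfolding lex_less_def by blast
        have "k \<notin> underS r j" using settled_agree[OF aj b(1)] k(2) by fastforce
        then show ?thesis using underS_cases[OF W k(1) jF] k b(2) by (metis less_imp_le order_refl)
      qed (simp add: b)
    qed
    then have "Sup (S j) \<le> a j" using S[OF jF] by (intro cSup_least) auto
    moreover have "a j \<le> p j" using p_ge[OF jF, of "a j"] aj by (simp add: S_def)
    ultimately show ?thesis using jF by (simp add: p_def)
  qed
  have upper: "lex_less r a p \<or> (\<forall>i\<in>Field r. a i = p i)" if a: "a \<in> A" for a
  proof (cases "\<exists>b\<in>A. lex_less r a b")
    case False
    have max: "a \<in> settled i" for i using False a by (auto simp: settled_def)
    show ?thesis
    proof (rule disjCI)
      assume "\<not> (\<forall>i\<in>Field r. a i = p i)"
      then obtain i0 where "i0 \<in> {i \<in> Field r. a i \<noteq> p i}" by blast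
      from underS_least[OF W this] obtain i where i: "i \<in> Field r" "a i \<noteq> p i"
        and least: "\<forall>j\<in>underS r i. j \<notin> {i \<in> Field r. a i \<noteq> p i}" by blast
      then have "\<forall>j\<in>underS r i. a j = p j" using underS_in_Field by fastforce
      moreover have "a i \<le> p i" using p_ge[OF i(1), of "a i"] max by (simp add: S_def)
      ultimately show "lex_less r a p" using i unfolding lex_less_def
        by (metis order_less_le)
    qed
  next
    case True
    let ?K = "{i \<in> Field r. \<exists>b\<in>A. a i < b i \<and> (\<forall>j\<in>underS r i. a j = b j)}"
    from True obtain i0 where "i0 \<in> ?K" unfolding lex_less_def by blast
    from underS_least[OF W this] obtain i where "i \<in> ?K" and least: "\<forall>j\<in>underS r i. j \<notin> ?K"
      by (elim bexE)
    then obtain b where iF: "i \<in> Field r" and b: "b \<in> A" "a i < b i" "\<forall>j\<in>underS r i. a j = b j"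
      by blast
    \<comment> \<open>An element above \<open>b\<close> that changed a coordinate below
      \<open>i\<close> would exceed \<open>a\<close> there, against the minimality of
      \<open>i\<close>.\<close>
    have "b \<in> settled i"
      unfolding settled_def
    proof (intro CollectI conjI ballI impI b(1))
      fix c j assume c: "c \<in> A" "lex_less r b c" and j: "j \<in> underS r i"
      then obtain k where k: "k \<in> Field r" "b k < c k" "\<forall>m\<in>underS r k. b m = c m"
        unfolding lex_less_def by blast
      have "k \<notin> underS r i"
      proof
        assume ki: "k \<in> underS r i"
        then have "a k < c k" using b(3) k(2) by simp
        moreover have "\<forall>m\<in>underS r k. a m = c m"
          using b(3) k(3) underS_trans[OF W _ ki] by simp
        ultimately have "k \<in> ?K" using k(1) c(1) by blast
        then show False using least ki by blast
      qed
      then have "j \<in> underS r k"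
        using underS_cases[OF W k(1) iF] underS_trans[OF W j] j by metis
      then show "b j = c j" using k(3) by blast
    qed
    then have "\<forall>j\<in>underS r i. p j = b j" "b i \<le> p i"
      using p_settled p_ge[OF iF, of "b i"] by (auto simp: S_def)
    then show ?thesis using iF b unfolding lex_less_def by (metis less_le_trans)
  qed
  have least: "lex_less r p b \<or> (\<forall>i\<in>Field r. b i = p i)"
    if b: "\<forall>i\<in>Field r. -1 \<le> b i" and ub: "\<forall>a\<in>A. lex_less r a b" for b
  proof (rule ccontr)
    assume *: "\<not> (lex_less r p b \<or> (\<forall>i\<in>Field r. b i = p i))"
    then have "lex_less r b p" using lex_less_linear[OF W] by blast
    then obtain i where i: "i \<in> Field r" "b i < p i" "\<forall>j\<in>underS r i. b j = p j"
      unfolding lex_less_def by blast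
    have "b i < Sup (S i)" using i by (simp add: p_def)
    then obtain s where s: "s \<in> S i" "b i < s"
      using less_cSup_iff[of "S i" "b i"] S[OF i(1)] by blast
    \<comment> \<open>\<open>s\<close> is not the default \<open>-1\<close>, because
      \<open>-1 \<le> b i < s\<close>.\<close>
    then obtain a where a: "a \<in> settled i" "s = a i"
      using b i(1) by (auto simp: S_def)
    have "\<forall>j\<in>underS r i. b j = a j" using p_settled[OF a(1)] i(3) by simp
    then have "lex_less r b a" using i(1) s(2) a(2) unfolding lex_less_def by blast
    moreover have "lex_less r a b" using a(1) ub by (simp add: settled_def)
    ultimately show False using lex_less_asym[OF W] by blast
  qed
  show ?thesis using range upper least by (intro exI[of _ p]) simp
qed

text \<open>The first difference lies below \<open>d\<close>, so the comparison depends only on the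
  coordinates there. This transfers comparisons with a supremum to points that share only its
  prefix.\<close>

lemma lex_less_prefix:
  assumes W: "Well_order r" and xy: "lex_less r x y" and i: "i \<in> underS r d" "x i \<noteq> y i"
    and eq: "\<And>j. j \<in> underS r d \<Longrightarrow> x j = x' j" "\<And>j. j \<in> underS r d \<Longrightarrow> y j = y' j"
  shows "lex_less r x' y'"
proof -
  obtain k where k: "k \<in> Field r" "x k < y k" "\<forall>j\<in>underS r k. x j = y j"
    using xy unfolding lex_less_def by blast
  have dF: "d \<in> Field r" using underS_in_Field[OF i(1)] by simp
  have kd: "k \<in> underS r d"
  proof (rule underS_cases[OF W k(1) dF])
    assume "k = d"
    then show ?thesis using i k(3) by blast
  next
    assume "d \<in> underS r k"
    then show ?thesis using i k(3) underS_trans[OF W i(1)] by blast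
  qed
  then have "x' k < y' k" using k(2) eq by simp
  moreover have "\<forall>j\<in>underS r k. x' j = y' j"
    using k(3) eq underS_trans[OF W _ kd] by metis
  ultimately show ?thesis using k(1) unfolding lex_less_def by blast
qed

text \<open>
  The filling points agree up to a countable \<open>d\<close> with the supremum \<open>p\<close> of \<open>A\<close> and continue with
  a copy of the whole ordering. The coordinate at \<open>d\<close> keeps them off the one element of \<open>A\<close> or
  \<open>B\<close> that can agree with \<open>p\<close> below \<open>d\<close>.
\<close>

lemma fill_countable_cut:
  assumes A: "A \<subseteq> L_omega1" "countable A" and B: "B \<subseteq> L_omega1" "countable B"
    and AB: "\<And>a b. a \<in> A \<Longrightarrow> b \<in> B \<Longrightarrow> L_less a b"
  obtains e where "\<And>x. x \<in> L_omega1 \<Longrightarrow> e x \<in> L_omega1"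
    and "\<And>x y. x \<in> L_omega1 \<Longrightarrow> y \<in> L_omega1 \<Longrightarrow> L_less x y \<Longrightarrow> L_less (e x) (e y)"
    and "\<And>a x. a \<in> A \<Longrightarrow> x \<in> L_omega1 \<Longrightarrow> L_less a (e x)"
    and "\<And>b x. b \<in> B \<Longrightarrow> x \<in> L_omega1 \<Longrightarrow> L_less (e x) b"
proof -
  note W = Well_order_omega1
  have "countable (A \<union> B)" "A \<union> B \<subseteq> L_omega1" using A B by auto
  then obtain d where dF: "d \<in> Field omega1" and d: "A \<union> B \<subseteq> level d"
    by (rule countable_subset_level)
  have "\<exists>p. (\<forall>i. -1 \<le> p i \<and> p i \<le> 1) \<and>
    (\<forall>a\<in>A. L_less a p \<or> (\<forall>i\<in>Field omega1. a i = p i)) \<and>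
    (\<forall>b. (\<forall>i\<in>Field omega1. -1 \<le> b i) \<and> (\<forall>a\<in>A. L_less a b) \<longrightarrow>
      L_less p b \<or> (\<forall>i\<in>Field omega1. b i = p i))"
  proof (rule lex_sup[OF W])
    show "-1 \<le> a i \<and> a i \<le> 1" if "a \<in> A" "i \<in> Field omega1" for a i
      using that A L_omega1_range by blast
    show "a = b \<or> L_less a b \<or> L_less b a" if "a \<in> A" "b \<in> A" for a b
      using that A by (intro L_less_linear) auto
  qed
  \<comment> \<open>\<open>p\<close> itself need not lie in \<open>L_omega1\<close>: if
    \<open>A\<close> has no maximum, \<open>p\<close> is \<open>-1\<close> from \<open>d\<close> on.
    Only its coordinates below \<open>d\<close> enter the construction.\<close>
  then obtain p where p_range: "\<forall>i. -1 \<le> p i \<and> p i \<le> 1"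
    and p_upper: "\<forall>a\<in>A. L_less a p \<or> (\<forall>i\<in>Field omega1. a i = p i)"
    and p_least: "\<forall>b. (\<forall>i\<in>Field omega1. -1 \<le> b i) \<and> (\<forall>a\<in>A. L_less a b) \<longrightarrow>
      L_less p b \<or> (\<forall>i\<in>Field omega1. b i = p i)"
    by (elim exE conjE)
  obtain h where h: "\<forall>i. d \<in> underS omega1 (h i) \<and>
      (\<forall>j\<in>underS omega1 i. h j \<in> underS omega1 (h i))"
    using omega1_shift[OF dF] by (elim exE)
  then have h_gt: "\<And>i. d \<in> underS omega1 (h i)"
    and h_mono: "\<And>i j. i \<in> underS omega1 j \<Longrightarrow> h i \<in> underS omega1 (h j)"
    by simp_all
  have under_Field: "underS omega1 i \<subseteq> Field omega1" for i
    using underS_in_Field by fastforce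
  have h_inj: "inj_on h (Field omega1)"
  proof (rule inj_onI)
    fix i j assume ij: "i \<in> Field omega1" "j \<in> Field omega1" "h i = h j"
    then show "i = j"
      using omega1_cases[OF ij(1,2)] h_mono[of i j] h_mono[of j i] underS_irrefl by metis
  qed
  have h_notin: "h i \<notin> underS omega1 d" "h i \<noteq> d" for i
    using h_gt[of i] omega1_trans[of d "h i" d] by (auto simp: underS_irrefl)
  have h_Field: "h i \<in> Field omega1" for i using underS_in_Field[OF h_gt] by simp
  define agree where "agree x \<longleftrightarrow> (\<forall>i\<in>underS omega1 d. x i = p i)" for x
  \<comment> \<open>Elements of \<open>A \<union> B\<close> are 0 at \<open>d\<close>, so the sign
    of \<open>c\<close> decides on which side of an element with prefix \<open>p\<close> the copy
    lies.\<close>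
  define c :: real where "c = (if \<exists>b\<in>B. agree b then -1/2 else 1/2)"
  \<comment> \<open>The image of \<open>h\<close> need not contain every position beyond
    \<open>d\<close>; the value 0 at the others keeps the support countable.\<close>
  define e where "e x = (\<lambda>i\<in>Field omega1. if i \<in> underS omega1 d then p i else if i = d then c
    else if i \<in> h ` Field omega1 then x (inv_into (Field omega1) h i) else 0)"
    for x :: "nat set \<Rightarrow> real"
  have e_below: "e x i = p i" if "i \<in> underS omega1 d" for x i
    using that under_Field by (auto simp: e_def)
  have e_d: "e x d = c" for x using dF by (simp add: e_def underS_irrefl)
  have e_h: "e x (h k) = x k" if "k \<in> Field omega1" for x k
    using that h_notin[of k] h_Field[of k] h_inj by (simp add: e_def)
  have e_0: "e x i = 0"
    if "i \<in> Field omega1" "i \<notin> underS omega1 d" "i \<noteq> d" "i \<notin> h ` Field omega1" for x i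
    using that by (simp add: e_def)
  have e_L: "e x \<in> L_omega1" if x: "x \<in> L_omega1" for x
  proof -
    have "e x i \<in> {-1..1}" if i: "i \<in> Field omega1" for i
    proof -
      consider "i \<in> underS omega1 d" | "i = d" | k where "k \<in> Field omega1" "i = h k"
        | "i \<notin> underS omega1 d" "i \<noteq> d" "i \<notin> h ` Field omega1" by blast
      then show ?thesis
      proof cases
        case 1
        then show ?thesis using p_range by (simp add: e_below)
      next
        case 2
        then show ?thesis by (simp add: e_d c_def)
      next
        case 3
        then show ?thesis using L_omega1_range[OF x] by (simp add: e_h)
      next
        case 4
        then show ?thesis using i by (simp add: e_0)
      qed
    qed
    moreover have "{i \<in> Field omega1. e x i \<noteq> 0} \<subseteq>
        insert d (underS omega1 d) \<union> h ` {i \<in> Field omega1. x i \<noteq> 0}"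
    proof
      fix i assume i: "i \<in> {i \<in> Field omega1. e x i \<noteq> 0}"
      show "i \<in> insert d (underS omega1 d) \<union> h ` {i \<in> Field omega1. x i \<noteq> 0}"
      proof (cases "i \<in> h ` Field omega1")
        case True
        then show ?thesis using i by (auto simp: e_h)
      next
        case False
        then show ?thesis using i e_0[of i x] by auto
      qed
    qed
    then have "countable {i \<in> Field omega1. e x i \<noteq> 0}"
      by (rule countable_subset)
        (use x countable_underS_omega1 in \<open>auto simp: L_omega1_def\<close>)
    ultimately show ?thesis
      by (auto simp: L_omega1_def interval_pow_def e_def)
  qed
  have e_mono: "L_less (e x) (e y)" if "L_less x y" for x y
  proof -
    obtain k where k: "k \<in> Field omega1" "x k < y k" "\<forall>j\<in>underS omega1 k. x j = y j"
      using \<open>L_less x y\<close> unfolding lex_less_def by blast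
    have "e x j = e y j" if j: "j \<in> underS omega1 (h k)" for j
    proof (cases "j \<in> h ` Field omega1")
      case True
      then obtain m where m: "m \<in> Field omega1" "j = h m" by blast
      have "h m \<noteq> h k" "h k \<notin> underS omega1 (h m)"
        using j m(2) omega1_trans[of "h m" "h k" "h m"] by (auto simp: underS_irrefl)
      then have "m \<in> underS omega1 k"
        using omega1_cases[OF m(1) k(1)] h_mono[of k m] by metis
      then show ?thesis using k(3) m by (simp add: e_h)
    next
      case False
      then show ?thesis by (simp add: e_def)
    qed
    then show ?thesis using k h_Field unfolding lex_less_def by (metis e_h)
  qed
  have zero: "x i = 0" if "x \<in> A \<union> B" "i \<in> Field omega1" "i \<notin> underS omega1 d" for x i
    using that d by (auto simp: level_def)
  \<comment> \<open>Elements of \<open>A\<close> and \<open>B\<close> that both have the prefix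
    \<open>p\<close> would coincide at all positions, since both vanish from \<open>d\<close>
    on.\<close>
  have not_both: "\<not> agree b" if ab: "a \<in> A" "b \<in> B" "agree a" for a b
  proof
    assume "agree b"
    obtain i where i: "i \<in> Field omega1" "a i < b i"
      using AB[OF ab(1,2)] unfolding lex_less_def by blast
    show False
      using i zero[of a i] zero[of b i] ab \<open>agree b\<close> unfolding agree_def
      by (cases "i \<in> underS omega1 d") auto
  qed
  have lower: "L_less a (e x)" if a: "a \<in> A" for a x
  proof (cases "agree a")
    case True
    then have "c = 1/2" using not_both[OF a] by (auto simp: c_def)
    then have "a d < e x d" using zero[of a d] a dF by (simp add: e_d underS_irrefl)
    moreover have "\<forall>i\<in>underS omega1 d. a i = e x i" using True by (simp add: agree_def e_below)
    ultimately show ?thesis using dF unfolding lex_less_def by blast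
  next
    case False
    then obtain i where i: "i \<in> underS omega1 d" "a i \<noteq> p i" by (auto simp: agree_def)
    then have "L_less a p" using p_upper a under_Field by blast
    from lex_less_prefix[OF W this i] show ?thesis by (simp add: e_below)
  qed
  have upper: "L_less (e x) b" if b: "b \<in> B" for b x
  proof (cases "agree b")
    case True
    then have "c = -1/2" using b by (auto simp: c_def)
    then have "e x d < b d" using zero[of b d] b dF by (simp add: e_d underS_irrefl)
    moreover have "\<forall>i\<in>underS omega1 d. e x i = b i" using True by (simp add: agree_def e_below)
    ultimately show ?thesis using dF unfolding lex_less_def by blast
  next
    case False
    then obtain i where i: "i \<in> underS omega1 d" "p i \<noteq> b i" by (auto simp: agree_def)
    have "\<forall>i\<in>Field omega1. -1 \<le> b i" "\<forall>a\<in>A. L_less a b"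
      using b B L_omega1_range AB by auto
    with p_least have "L_less p b \<or> (\<forall>i\<in>Field omega1. b i = p i)" by simp
    then have "L_less p b" using i under_Field by fastforce
    from lex_less_prefix[OF W this i] show ?thesis by (simp add: e_below)
  qed
  show ?thesis using e_L e_mono lower upper by (intro that[of e])
qed

section \<open>Back and forth\<close>

text \<open>With graphs, extension is inclusion, stages are joined by unions, and
  \<open>G\<inverse>\<close> exchanges forth and back. Linearity makes such a graph single-valued
  and injective.\<close>

definition short_iso :: "((nat set \<Rightarrow> real) \<times> (nat set \<Rightarrow> real)) set \<Rightarrow> bool"
  where "short_iso G \<longleftrightarrow> G \<subseteq> L_omega1 \<times> L_omega1 \<and> short (Domain G) \<and>
    (\<forall>(a, b)\<in>G. \<forall>(c, d)\<in>G. L_less a c \<longleftrightarrow> L_less b d)"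

lemma short_isoD:
  assumes "short_iso G"
  shows "G \<subseteq> L_omega1 \<times> L_omega1" "short (Domain G)"
    and "(a, b) \<in> G \<Longrightarrow> (c, d) \<in> G \<Longrightarrow> L_less a c \<longleftrightarrow> L_less b d"
  using assms by (auto simp: short_iso_def)

lemma short_iso_inj:
  assumes "short_iso G" "(a, b) \<in> G" "(c, d) \<in> G"
  shows "a = c \<longleftrightarrow> b = d"
proof -
  have "a \<in> L_omega1" "b \<in> L_omega1" "c \<in> L_omega1" "d \<in> L_omega1"
    using short_isoD(1)[OF assms(1)] assms(2,3) by auto
  then show ?thesis
    using L_less_linear[of a c] L_less_linear[of b d] lex_less_irrefl
      short_isoD(3)[OF assms] short_isoD(3)[OF assms(1,3,2)] by metis
qed

lemma short_Range:
  assumes G: "short_iso G"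
  shows "short (Range G)"
proof -
  have iff: "L_less a c \<longleftrightarrow> L_less b d" if "(a, b) \<in> G" "(c, d) \<in> G" for a b c d
    using short_isoD(3)[OF G that] .
  have single: "b = d" if "(a, b) \<in> G" "(a, d) \<in> G" for a b d
    using short_iso_inj[OF G that] by simp
  show ?thesis
    using short_isoD(2)[OF G] unfolding short_def
    by (auto intro!: countably_cofinal_Range[of _ G] dest: iff single)
qed

lemma short_iso_converse:
  assumes G: "short_iso G"
  shows "short_iso (G\<inverse>)"
  using G short_Range[OF G] unfolding short_iso_def by auto

lemma short_iso_UN:
  assumes I: "countable I" and G: "\<And>i. i \<in> I \<Longrightarrow> short_iso (G i)"
    and chain: "\<And>i j. i \<in> I \<Longrightarrow> j \<in> I \<Longrightarrow> G i \<subseteq> G j \<or> G j \<subseteq> G i"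
  shows "short_iso (\<Union>i\<in>I. G i)"
  unfolding short_iso_def
proof (intro conjI)
  show "(\<Union>i\<in>I. G i) \<subseteq> L_omega1 \<times> L_omega1" using short_isoD(1)[OF G] by blast
  have "Domain (\<Union>i\<in>I. G i) = (\<Union>i\<in>I. Domain (G i))" by blast
  then show "short (Domain (\<Union>i\<in>I. G i))" using short_UN[OF I] short_isoD(2)[OF G] by simp
  have "L_less a c \<longleftrightarrow> L_less b d"
    if ab: "i \<in> I" "(a, b) \<in> G i" and cd: "j \<in> I" "(c, d) \<in> G j" for a b c d i j
    using chain[OF ab(1) cd(1)]
  proof
    assume "G i \<subseteq> G j"
    then show ?thesis using ab cd short_isoD(3)[OF G[OF cd(1)], of a b c d] by auto
  next
    assume "G j \<subseteq> G i"
    then show ?thesis using ab cd short_isoD(3)[OF G[OF ab(1)], of a b c d] by auto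
  qed
  then show "\<forall>(a, b)\<in>(\<Union>i\<in>I. G i). \<forall>(c, d)\<in>(\<Union>i\<in>I. G i). L_less a c \<longleftrightarrow> L_less b d"
    by (intro ballI) (auto split: prod.split)
qed

text \<open>A countable cofinal part of \<open>A\<close> and a countable coinitial part of
  \<open>B\<close> bound the same gap, which reduces the claim to countable sides.\<close>

lemma fill_short_cut:
  assumes Y: "short Y" "Y \<subseteq> L_omega1" and sub: "A \<subseteq> Y" "B \<subseteq> Y"
    and AB: "\<forall>a\<in>A. \<forall>b\<in>B. L_less a b"
  shows "\<exists>e. (\<forall>x\<in>L_omega1. e x \<in> L_omega1) \<and>
    (\<forall>x\<in>L_omega1. \<forall>y\<in>L_omega1. L_less x y \<longrightarrow> L_less (e x) (e y)) \<and>
    (\<forall>a\<in>A. \<forall>x\<in>L_omega1. L_less a (e x)) \<and> (\<forall>b\<in>B. \<forall>x\<in>L_omega1. L_less (e x) b)"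
proof -
  obtain A0 where A0: "A0 \<subseteq> A" "countable A0" "\<forall>a\<in>A. \<exists>d\<in>A0. a = d \<or> L_less a d"
    using countably_cofinalD[of L_less Y A] Y(1) sub(1) unfolding short_def
    by (elim exE conjE) auto
  obtain B0 where B0: "B0 \<subseteq> B" "countable B0" "\<forall>b\<in>B. \<exists>d\<in>B0. b = d \<or> L_less d b"
    using countably_cofinalD[of "\<lambda>x y. L_less y x" Y B] Y(1) sub(2) unfolding short_def
    by (elim exE conjE) auto
  have sub0: "A0 \<subseteq> L_omega1" "B0 \<subseteq> L_omega1" using A0(1) B0(1) sub Y(2) by auto
  have lt0: "L_less a b" if "a \<in> A0" "b \<in> B0" for a b using AB A0(1) B0(1) that by auto
  show ?thesis
  proof (rule fill_countable_cut[OF sub0(1) A0(2) sub0(2) B0(2) lt0])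
    fix e
    assume e: "\<And>x. x \<in> L_omega1 \<Longrightarrow> e x \<in> L_omega1"
      "\<And>x y. x \<in> L_omega1 \<Longrightarrow> y \<in> L_omega1 \<Longrightarrow> L_less x y \<Longrightarrow> L_less (e x) (e y)"
      and lower: "\<And>a x. a \<in> A0 \<Longrightarrow> x \<in> L_omega1 \<Longrightarrow> L_less a (e x)"
      and upper: "\<And>b x. b \<in> B0 \<Longrightarrow> x \<in> L_omega1 \<Longrightarrow> L_less (e x) b"
    have "L_less a (e x)" if "a \<in> A" "x \<in> L_omega1" for a x
      using A0(3) that lower L_less_trans by metis
    moreover have "L_less (e x) b" if "b \<in> B" "x \<in> L_omega1" for b x
      using B0(3) that upper L_less_trans by metis
    ultimately show ?thesis using e by (intro exI[of _ e]) simp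
  qed
qed

lemma forth:
  assumes G: "short_iso G" and S: "short S" "S \<subseteq> L_omega1"
  shows "\<exists>G'. short_iso G' \<and> G \<subseteq> G' \<and> S \<subseteq> Domain G'"
proof -
  define lo where "lo s = {b. \<exists>a. (a, b) \<in> G \<and> L_less a s}" for s
  define hi where "hi s = {b. \<exists>a. (a, b) \<in> G \<and> L_less s a}" for s
  define fills where "fills e A B \<longleftrightarrow> (\<forall>x\<in>L_omega1. e x \<in> L_omega1) \<and>
    (\<forall>x\<in>L_omega1. \<forall>y\<in>L_omega1. L_less x y \<longrightarrow> L_less (e x) (e y)) \<and>
    (\<forall>a\<in>A. \<forall>x\<in>L_omega1. L_less a (e x)) \<and> (\<forall>b\<in>B. \<forall>x\<in>L_omega1. L_less (e x) b)"
    for e :: "(nat set \<Rightarrow> real) \<Rightarrow> (nat set \<Rightarrow> real)" and A B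
  \<comment> \<open>The embedding is chosen for the image cut and not for \<open>s\<close>, so all
    new elements in one cut share it.\<close>
  define E where "E A B = (SOME e. fills e A B)" for A B
  define T where "T = S - Domain G"
  define e where "e s = E (lo s) (hi s) s" for s
  have T: "s \<in> L_omega1" "s \<notin> Domain G" if "s \<in> T" for s
    using that S(2) by (auto simp: T_def)
  have Gs: "a \<in> L_omega1" "b \<in> L_omega1" if "(a, b) \<in> G" for a b
    using short_isoD(1)[OF G] that by auto
  have E: "fills (E (lo s) (hi s)) (lo s) (hi s)" for s
  proof -
    have "\<forall>a\<in>lo s. \<forall>b\<in>hi s. L_less a b"
    proof (intro ballI)
      fix b d assume "b \<in> lo s" "d \<in> hi s"
      then obtain a c where "(a, b) \<in> G" "L_less a s" "(c, d) \<in> G" "L_less s c"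
        by (auto simp: lo_def hi_def)
      then show "L_less b d" using short_isoD(3)[OF G] L_less_trans by metis
    qed
    moreover have "lo s \<subseteq> Range G" "hi s \<subseteq> Range G" "Range G \<subseteq> L_omega1"
      using short_isoD(1)[OF G] by (auto simp: lo_def hi_def)
    ultimately have "\<exists>e. fills e (lo s) (hi s)"
      unfolding fills_def by (intro fill_short_cut[OF short_Range[OF G]])
    then show ?thesis unfolding E_def by (rule someI_ex)
  qed
  have e_L: "e s \<in> L_omega1" if "s \<in> T" for s
    using E[of s] T(1)[OF that] by (simp add: fills_def e_def)
  have e_gt: "L_less b (e s)" if "(a, b) \<in> G" "L_less a s" "s \<in> T" for a b s
    using E[of s] T(1)[OF that(3)] that(1,2) by (auto simp: fills_def e_def lo_def)
  have e_lt: "L_less (e s) b" if "(a, b) \<in> G" "L_less s a" "s \<in> T" for a b s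
    using E[of s] T(1)[OF that(3)] that(1,2) by (auto simp: fills_def e_def hi_def)
  have e_mono: "L_less (e s) (e t)" if st: "s \<in> T" "t \<in> T" "L_less s t" for s t
  proof (cases "\<exists>(a, b)\<in>G. L_less s a \<and> L_less a t")
    case True
    then obtain a b where ab: "(a, b) \<in> G" "L_less s a" "L_less a t" by blast
    show ?thesis using e_lt[OF ab(1,2) st(1)] e_gt[OF ab(1,3) st(2)] by (rule L_less_trans)
  next
    case False
    \<comment> \<open>No element of the domain separates \<open>s\<close> from \<open>t\<close>, so
      both determine the same cut and are mapped by the same increasing embedding.\<close>
    have less_iff: "(L_less a s \<longleftrightarrow> L_less a t) \<and> (L_less s a \<longleftrightarrow> L_less t a)"
      if ab: "(a, b) \<in> G" for a b
    proof -
      have "a \<noteq> s" "a \<noteq> t" using ab T(2) st by blast+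
      moreover have "\<not> (L_less s a \<and> L_less a t)" using False ab by blast
      ultimately show ?thesis
        using L_less_linear[OF Gs(1)[OF ab] T(1)[OF st(1)]] L_less_trans[of a s t]
          L_less_linear[OF Gs(1)[OF ab] T(1)[OF st(2)]] L_less_trans[of s t a] st(3)
        by metis
    qed
    then have "lo s = lo t" "hi s = hi t" unfolding lo_def hi_def by blast+
    then show ?thesis
      using E[of s] T(1)[OF st(1)] T(1)[OF st(2)] st(3) by (simp add: fills_def e_def)
  qed
  define G' where "G' = G \<union> (\<lambda>s. (s, e s)) ` T"
  have G'_L: "G' \<subseteq> L_omega1 \<times> L_omega1"
    using short_isoD(1)[OF G] e_L T(1) by (auto simp: G'_def)
  have single: "b = d" if "(a, b) \<in> G'" "(a, d) \<in> G'" for a b d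
    using that short_iso_inj[OF G, of a b a d] T(2) by (auto simp: G'_def)
  have inc: "L_less b d" if ab: "(a, b) \<in> G'" and cd: "(c, d) \<in> G'" and ac: "L_less a c" for a b c d
  proof -
    consider "(a, b) \<in> G" | "a \<in> T" "b = e a" using ab by (auto simp: G'_def)
    moreover consider "(c, d) \<in> G" | "c \<in> T" "d = e c" using cd by (auto simp: G'_def)
    ultimately show ?thesis
      using short_isoD(3)[OF G] e_gt e_lt e_mono ac by metis
  qed
  have iff: "L_less a c \<longleftrightarrow> L_less b d" if ab: "(a, b) \<in> G'" and cd: "(c, d) \<in> G'" for a b c d
  proof
    assume "L_less b d"
    moreover have "a = c \<or> L_less a c \<or> L_less c a"
      using G'_L ab cd by (intro L_less_linear) auto
    ultimately show "L_less a c"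
      using single[of a b d] ab cd inc[OF cd ab] L_less_asym lex_less_irrefl by metis
  qed (rule inc[OF ab cd])
  have "T \<subseteq> S" by (auto simp: T_def)
  then have "Domain G' = Domain G \<union> T" "short T"
    using S(1) countably_cofinal_subset by (auto simp: G'_def short_def)
  then have "short (Domain G')" using short_Un short_isoD(2)[OF G] by simp
  then have "short_iso G'" using G'_L iff unfolding short_iso_def by auto
  moreover have "G \<subseteq> G'" "S \<subseteq> Domain G'" by (auto simp: G'_def T_def)
  ultimately show ?thesis by blast
qed

lemma back_and_forth:
  assumes G: "short_iso G" and S: "short S" "S \<subseteq> L_omega1"
  shows "\<exists>G'. short_iso G' \<and> G \<subseteq> G' \<and> S \<subseteq> Domain G' \<and> S \<subseteq> Range G'"
proof -
  obtain G1 where G1: "short_iso G1" "G \<subseteq> G1" "S \<subseteq> Domain G1"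
    using forth[OF G S] by blast
  obtain G2 where G2: "short_iso G2" "G1\<inverse> \<subseteq> G2" "S \<subseteq> Domain G2"
    using forth[OF short_iso_converse[OF G1(1)] S] by blast
  have "short_iso (G2\<inverse>)" using short_iso_converse[OF G2(1)] .
  moreover have "G1 \<subseteq> G2\<inverse>" "S \<subseteq> Range (G2\<inverse>)" using G2 by auto
  ultimately show ?thesis using G1 by blast
qed

lemma short_iso_extends:
  assumes X: "X \<subseteq> L_omega1" and Y: "Y \<subseteq> L_omega1" and short: "short X"
    and f: "order_iso L_less X L_less Y f"
  shows "\<exists>g. order_iso L_less L_omega1 L_less L_omega1 g \<and> (\<forall>x\<in>X. g x = f x)"
proof -
  define G0 where "G0 = (\<lambda>x. (x, f x)) ` X"
  have fY: "f x \<in> Y" if "x \<in> X" for x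
    using f that by (auto simp: order_iso_def bij_betw_def)
  have G0: "short_iso G0"
    unfolding short_iso_def
  proof (intro conjI)
    show "G0 \<subseteq> L_omega1 \<times> L_omega1" using X Y fY by (auto simp: G0_def)
    have "Domain G0 = X" by (auto simp: G0_def)
    then show "short (Domain G0)" using short by simp
    show "\<forall>(a, b)\<in>G0. \<forall>(c, d)\<in>G0. L_less a c \<longleftrightarrow> L_less b d"
      using f by (auto simp: G0_def order_iso_def)
  qed
  let ?R = "{(i, j). i \<in> underS omega1 j}"
  \<comment> \<open>\<open>P\<close> consults \<open>G\<close> only below \<open>i\<close>, as the
    recursion requires; containing all earlier stages makes the stages a chain.\<close>
  define P where "P G i H \<longleftrightarrow> short_iso H \<and> G0 \<subseteq> H \<and> (\<forall>j\<in>underS omega1 i. G j \<subseteq> H) \<and>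
    level i \<subseteq> Domain H \<and> level i \<subseteq> Range H"
    for G :: "nat set \<Rightarrow> ((nat set \<Rightarrow> real) \<times> (nat set \<Rightarrow> real)) set" and i H
  have "\<exists>G. \<forall>i. P G i (G i)"
  proof (rule dependent_wf_choice[OF wf_underS[OF Well_order_omega1]])
    fix F G :: "nat set \<Rightarrow> ((nat set \<Rightarrow> real) \<times> (nat set \<Rightarrow> real)) set" and i H
    assume "\<And>j. (j, i) \<in> ?R \<Longrightarrow> F j = G j"
    then show "P F i H = P G i H" by (simp add: P_def)
  next
    fix i G assume "\<And>j. (j, i) \<in> ?R \<Longrightarrow> P G j (G j)"
    then have IH: "P G j (G j)" if "j \<in> underS omega1 i" for j using that by simp
    \<comment> \<open>Inserting \<open>G0\<close> provides the starting point at the least position,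
      where there are no earlier stages.\<close>
    define H where "H = (\<Union>K\<in>insert G0 (G ` underS omega1 i). K)"
    have "short_iso H"
      unfolding H_def
    proof (rule short_iso_UN)
      show "countable (insert G0 (G ` underS omega1 i))" using countable_underS_omega1 by simp
      show "short_iso K" if "K \<in> insert G0 (G ` underS omega1 i)" for K
        using that G0 IH by (auto simp: P_def)
      have chain: "G j \<subseteq> G k \<or> G k \<subseteq> G j"
        if jk: "j \<in> underS omega1 i" "k \<in> underS omega1 i" for j k
      proof (rule omega1_cases[of j k])
        show "j \<in> Field omega1" "k \<in> Field omega1" using underS_in_Field jk by fast+
      qed (use IH[OF jk(1)] IH[OF jk(2)] in \<open>auto simp: P_def\<close>)
      have G0_sub: "G0 \<subseteq> G j" if "j \<in> underS omega1 i" for j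
        using IH[OF that] by (simp add: P_def)
      show "K \<subseteq> K' \<or> K' \<subseteq> K"
        if "K \<in> insert G0 (G ` underS omega1 i)" "K' \<in> insert G0 (G ` underS omega1 i)" for K K'
        using that by (elim insertE imageE) (simp_all add: chain G0_sub)
    qed
    moreover have "level i \<subseteq> L_omega1" by (auto simp: level_def)
    ultimately obtain H' where "short_iso H'" "H \<subseteq> H'" "level i \<subseteq> Domain H'" "level i \<subseteq> Range H'"
      using back_and_forth[OF _ short_level] by metis
    then show "\<exists>H. P G i H" unfolding P_def H_def by (intro exI[of _ H']) auto
  qed
  then obtain G where G: "\<forall>i. P G i (G i)" by blast
  define U where "U = (\<Union>i\<in>Field omega1. G i)"
  \<comment> \<open>\<open>U\<close> will have all of \<open>L_omega1\<close> as its domain, which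
    is not short, so it is no \<open>short_iso\<close>. Its properties come from the single stages,
    any two pairs of \<open>U\<close> lying in a common one.\<close>
  have U_pair: "\<exists>i\<in>Field omega1. (a, b) \<in> G i \<and> (c, d) \<in> G i"
    if ab: "(a, b) \<in> U" and cd: "(c, d) \<in> U" for a b c d
  proof -
    obtain i where i: "i \<in> Field omega1" "(a, b) \<in> G i" using ab by (auto simp: U_def)
    obtain j where j: "j \<in> Field omega1" "(c, d) \<in> G j" using cd by (auto simp: U_def)
    show ?thesis
    proof (rule omega1_cases[OF i(1) j(1)])
      assume "i \<in> underS omega1 j"
      then have "G i \<subseteq> G j" using G by (auto simp: P_def)
      then show ?thesis using i j by blast
    next
      assume "j \<in> underS omega1 i"
      then have "G j \<subseteq> G i" using G by (auto simp: P_def)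
      then show ?thesis using i j by blast
    qed (use i j in auto)
  qed
  have iso: "short_iso (G i)" for i using G by (simp add: P_def)
  have U_iff: "(L_less a c \<longleftrightarrow> L_less b d) \<and> (a = c \<longleftrightarrow> b = d)"
    if "(a, b) \<in> U" "(c, d) \<in> U" for a b c d
    using U_pair[OF that] short_isoD(3)[OF iso] short_iso_inj[OF iso] by metis
  have U_sub: "U \<subseteq> L_omega1 \<times> L_omega1"
    using short_isoD(1)[OF iso] by (auto simp: U_def)
  have "x \<in> Domain U \<and> x \<in> Range U" if "x \<in> L_omega1" for x
  proof -
    have "countable {x}" "{x} \<subseteq> L_omega1" using that by auto
    then obtain i where i: "i \<in> Field omega1" "{x} \<subseteq> level i" by (rule countable_subset_level)
    then have "x \<in> Domain (G i)" "x \<in> Range (G i)" using G by (auto simp: P_def)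
    then show ?thesis using i(1) unfolding U_def by blast
  qed
  then have dom: "\<forall>x\<in>L_omega1. \<exists>y. (x, y) \<in> U" and ran: "\<forall>y\<in>L_omega1. \<exists>x. (x, y) \<in> U"
    by blast+
  from dom obtain g where g: "\<forall>x\<in>L_omega1. (x, g x) \<in> U" by metis
  have g_eq: "g x = y" if xy: "(x, y) \<in> U" for x y
  proof -
    have "x \<in> L_omega1" using U_sub xy by blast
    then show ?thesis using U_iff[OF xy, of x "g x"] g by simp
  qed
  have "bij_betw g L_omega1 L_omega1"
    unfolding bij_betw_def
  proof (intro conjI equalityI subsetI)
    show "inj_on g L_omega1"
      using g U_iff by (intro inj_onI) metis
    show "y \<in> L_omega1" if "y \<in> g ` L_omega1" for y using that g U_sub by blast
    show "y \<in> g ` L_omega1" if "y \<in> L_omega1" for y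
    proof -
      obtain x where x: "(x, y) \<in> U" using ran \<open>y \<in> L_omega1\<close> by blast
      then have "y = g x" "x \<in> L_omega1" using g_eq[OF x] U_sub by auto
      then show ?thesis by (rule image_eqI)
    qed
  qed
  moreover have "\<forall>x\<in>L_omega1. \<forall>y\<in>L_omega1. L_less x y \<longleftrightarrow> L_less (g x) (g y)"
    using g U_iff by simp
  ultimately have "order_iso L_less L_omega1 L_less L_omega1 g" by (simp add: order_iso_def)
  moreover have "g x = f x" if "x \<in> X" for x
  proof -
    obtain i where i: "i \<in> Field omega1" using uncountable_Field_omega1 by fastforce
    have "G0 \<subseteq> G i" using G by (simp add: P_def)
    moreover have "(x, f x) \<in> G0" using \<open>x \<in> X\<close> by (simp add: G0_def)
    ultimately have "(x, f x) \<in> U" using i unfolding U_def by blast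
    then show ?thesis by (rule g_eq)
  qed
  ultimately show ?thesis by blast
qed

theorem proposition8:
  shows "(\<forall>X Y f. X \<subseteq> L_omega1 \<and> Y \<subseteq> L_omega1
            \<and> I_dim X L_less <o omega1 \<and> I_dim Y L_less <o omega1
            \<and> order_iso L_less X L_less Y f \<longrightarrow>
            (\<exists>g. order_iso L_less L_omega1 L_less L_omega1 g \<and> (\<forall>x\<in>X. g x = f x)))
       \<and> (\<forall>X Y f. X \<subseteq> L_omega1 \<and> Y \<subseteq> L_omega1
            \<and> countable X \<and> countable Y
            \<and> order_iso L_less X L_less Y f \<longrightarrow>
            (\<exists>g. order_iso L_less L_omega1 L_less L_omega1 g \<and> (\<forall>x\<in>X. g x = f x)))"
proof (intro conjI allI impI; elim conjE)
  fix X Y :: "(nat set \<Rightarrow> real) set" and f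
  assume "X \<subseteq> L_omega1" "Y \<subseteq> L_omega1" "I_dim X L_less <o omega1" "order_iso L_less X L_less Y f"
  then show "\<exists>g. order_iso L_less L_omega1 L_less L_omega1 g \<and> (\<forall>x\<in>X. g x = f x)"
    using short_iso_extends short_I_dim by blast
next
  fix X Y :: "(nat set \<Rightarrow> real) set" and f
  assume "X \<subseteq> L_omega1" "Y \<subseteq> L_omega1" "countable X" "order_iso L_less X L_less Y f"
  then show "\<exists>g. order_iso L_less L_omega1 L_less L_omega1 g \<and> (\<forall>x\<in>X. g x = f x)"
    using short_iso_extends short_countable by blast
qed

end
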